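(* Let $G$ be a graph on $n$ vertices and $e(G)$ edges, with maximum degree $\Delta$ and minimum degree $\delta$. Then: (i) $\alpha(G) \le \theta(G) \le S_0(G) \le \left\lfloor \frac{n-\Delta}{2} + \sqrt{\frac{(n-\Delta)^2}{4} + n\Delta - 2e(G)} \right\rfloor \le \left\lfloor \frac{1}{2} + \sqrt{\frac{1}{4} + n^2 - n - 2e(G)} \right\rfloor$; (ii) $\omega(G) \le \chi(G) \le L_0(G) \le \left\lfloor \frac{\delta+1}{2} + \sqrt{\frac{(\delta+1)^2}{4} - n\delta + 2e(G)} \right\rfloor \le \left\lfloor \frac{1}{2} + \sqrt{\frac{1}{4} + 2e(G)} \right\rfloor$.
   Context: Graphs are finite and simple with nonempty vertex set; $n = |V(G)|$. A set $A \subseteq V(G)$ is small if $\deg(v) \le n - |A|$ for every $v \in A$, and a set $B \subseteq V(G)$ is large if $\deg(v) \ge |B| - 1$ for every $v \in B$. $S_0(G)$ is the maximum cardinality of a small set and $L_0(G)$ the maximum cardinality of a large set of $G$. $\chi(G)$, $\omega(G)$, $\alpha(G)$ are the chromatic, clique and independence numbers; $\theta(G)$ is the clique-partition number, i.e. the minimum number of cliques into which $V(G)$ can be partitioned. *)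

theory Defs
  imports Complex_Main "HOL-Library.Disjoint_Sets"
begin

text \<open>
  A graph is given by its vertex set and its set of edges, an edge being a two-element set of
  vertices.
\<close>

locale simple_graph =
  fixes V :: "'a set" and E :: "'a set set"
  assumes finite_V: "finite V"
    and nonempty_V: "V \<noteq> {}"
    and edges: "E \<subseteq> {e. e \<subseteq> V \<and> card e = 2}"

definition degree :: "'a set \<Rightarrow> 'a set set \<Rightarrow> 'a \<Rightarrow> nat" where
  "degree V E v = card {u \<in> V. {u, v} \<in> E}"

definition max_degree :: "'a set \<Rightarrow> 'a set set \<Rightarrow> nat" where
  "max_degree V E = Max (degree V E ` V)"

definition min_degree :: "'a set \<Rightarrow> 'a set set \<Rightarrow> nat" where
  "min_degree V E = Min (degree V E ` V)"

definition clique :: "'a set \<Rightarrow> 'a set set \<Rightarrow> 'a set \<Rightarrow> bool" where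
  "clique V E K \<longleftrightarrow> K \<subseteq> V \<and> (\<forall>u\<in>K. \<forall>v\<in>K. u \<noteq> v \<longrightarrow> {u, v} \<in> E)"

definition independent :: "'a set \<Rightarrow> 'a set set \<Rightarrow> 'a set \<Rightarrow> bool" where
  "independent V E I \<longleftrightarrow> I \<subseteq> V \<and> (\<forall>u\<in>I. \<forall>v\<in>I. {u, v} \<notin> E)"

definition proper_colouring :: "'a set \<Rightarrow> 'a set set \<Rightarrow> nat \<Rightarrow> ('a \<Rightarrow> nat) \<Rightarrow> bool" where
  "proper_colouring V E k c \<longleftrightarrow>
     c ` V \<subseteq> {..<k} \<and> (\<forall>u\<in>V. \<forall>v\<in>V. {u, v} \<in> E \<longrightarrow> c u \<noteq> c v)"

text \<open>
  The subtractions in the next two definitions are on natural numbers but never truncate: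
  a small set is a subset of the finite set \<open>V\<close>, and the degree condition on a large set is only
  imposed at its elements.
\<close>

definition small :: "'a set \<Rightarrow> 'a set set \<Rightarrow> 'a set \<Rightarrow> bool" where
  "small V E A \<longleftrightarrow> A \<subseteq> V \<and> (\<forall>v\<in>A. degree V E v \<le> card V - card A)"

definition large :: "'a set \<Rightarrow> 'a set set \<Rightarrow> 'a set \<Rightarrow> bool" where
  "large V E B \<longleftrightarrow> B \<subseteq> V \<and> (\<forall>v\<in>B. degree V E v \<ge> card B - 1)"

definition S\<^sub>0 :: "'a set \<Rightarrow> 'a set set \<Rightarrow> nat" where
  "S\<^sub>0 V E = Max {card A | A. small V E A}"

definition L\<^sub>0 :: "'a set \<Rightarrow> 'a set set \<Rightarrow> nat" where
  "L\<^sub>0 V E = Max {card B | B. large V E B}"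

definition clique_number :: "'a set \<Rightarrow> 'a set set \<Rightarrow> nat" where
  "clique_number V E = Max {card K | K. clique V E K}"

definition independence_number :: "'a set \<Rightarrow> 'a set set \<Rightarrow> nat" where
  "independence_number V E = Max {card I | I. independent V E I}"

definition chromatic_number :: "'a set \<Rightarrow> 'a set set \<Rightarrow> nat" where
  "chromatic_number V E = (LEAST k. \<exists>c. proper_colouring V E k c)"

definition clique_partition_number :: "'a set \<Rightarrow> 'a set set \<Rightarrow> nat" where
  "clique_partition_number V E =
     (LEAST k. \<exists>P. partition_on V P \<and> (\<forall>K\<in>P. clique V E K) \<and> card P = k)"

end

theory Submission
  imports Defs
begin

text \<open>
  Writing \<open>k = L\<^sub>0\<close>, at most \<open>k\<close> vertices have degree at least \<open>k\<close> (any \<open>k + 1\<close> of them would form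
  a large set); colour these with distinct colours and the remaining ones greedily, which gives
  \<open>\<chi> \<le> L\<^sub>0\<close>. For a large set of size \<open>k\<close>, the degree sum yields \<open>k (k - 1) + (n - k) \<delta> \<le> 2 e\<close>, so
  \<open>k\<close> is at most the larger root of \<open>x\<^sup>2 - (\<delta> + 1) x + n \<delta> - 2 e\<close>. This root is at most \<open>n\<close>,
  and hence satisfies \<open>x (x - 1) = 2 e - \<delta> (n - x) \<le> 2 e\<close>. Part (i) is part (ii) for the complement
  graph, whose large sets are the small sets of the given graph.
\<close>

definition complement_edges :: "'a set \<Rightarrow> 'a set set \<Rightarrow> 'a set set" where
  "complement_edges V E = {e. e \<subseteq> V \<and> card e = 2} - E"

context simple_graph
begin

section \<open>Degree counting and extremal parameters\<close>

lemma finite_E: "finite E"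
  using edges finite_V by (auto intro: finite_subset[of _ "Pow V"])

lemma singleton_not_edge: "{v} \<notin> E"
  using edges by auto

text \<open>An edge at \<open>v\<close> is determined by its other end. Counting incident edges
  instead of neighbours is the form that double counting needs.\<close>

lemma degree_eq_card_incident:
  assumes "v \<in> V"
  shows "degree V E v = card {e \<in> E. v \<in> e}"
proof -
  have "bij_betw (\<lambda>u. {u, v}) {u \<in> V. {u, v} \<in> E} {e \<in> E. v \<in> e}"
    unfolding bij_betw_def
  proof
    show "inj_on (\<lambda>u. {u, v}) {u \<in> V. {u, v} \<in> E}"
      by (auto simp: inj_on_def doubleton_eq_iff)
    show "(\<lambda>u. {u, v}) ` {u \<in> V. {u, v} \<in> E} = {e \<in> E. v \<in> e}"
    proof
      show "{e \<in> E. v \<in> e} \<subseteq> (\<lambda>u. {u, v}) ` {u \<in> V. {u, v} \<in> E}"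
      proof
        fix e assume e: "e \<in> {e \<in> E. v \<in> e}"
        then obtain x y where "e = {x, y}"
          using edges by (auto simp: card_2_iff)
        with e obtain u where "e = {u, v}"
          by auto
        with e edges show "e \<in> (\<lambda>u. {u, v}) ` {u \<in> V. {u, v} \<in> E}"
          by auto
      qed
    qed auto
  qed
  then show ?thesis
    unfolding degree_def by (rule bij_betw_same_card)
qed

text \<open>Handshake lemma: count incident pairs of a vertex and an edge, each edge having exactly
  two ends.\<close>

lemma sum_degree: "(\<Sum>v\<in>V. degree V E v) = 2 * card E"
proof -
  have "(\<Sum>v\<in>V. card {e \<in> E. v \<in> e}) = 2 * card E"
  proof (rule sum_multicount[OF finite_V finite_E], rule ballI)
    fix e assume "e \<in> E"
    with edges have "{v \<in> V. v \<in> e} = e" "card e = 2"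
      by auto
    then show "card {v \<in> V. v \<in> e} = 2"
      by simp
  qed
  then show ?thesis
    by (simp add: degree_eq_card_incident)
qed

lemma degree_less_card:
  assumes "v \<in> V"
  shows "degree V E v < card V"
proof -
  have "{u \<in> V. {u, v} \<in> E} \<subseteq> V - {v}"
    using singleton_not_edge by auto
  then show ?thesis
    unfolding degree_def using assms finite_V by (intro psubset_card_mono) auto
qed

lemma min_degree_le: "v \<in> V \<Longrightarrow> min_degree V E \<le> degree V E v"
  unfolding min_degree_def using finite_V by simp

text \<open>Makes the maxima over large, clique and independent sets well defined; they are attained
  because the empty set always qualifies.\<close>

lemma finite_card_subsets: "finite {card A | A. A \<subseteq> V \<and> P A}"
  by (rule finite_subset[of _ "card ` Pow V"]) (use finite_V in auto)

lemma card_large_le: "large V E B \<Longrightarrow> card B \<le> L\<^sub>0 V E"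
  unfolding L\<^sub>0_def large_def by (intro Max_ge finite_card_subsets) auto

lemma L\<^sub>0_attained: "\<exists>B. large V E B \<and> card B = L\<^sub>0 V E"
proof -
  have "L\<^sub>0 V E \<in> {card B | B. large V E B}"
    unfolding L\<^sub>0_def large_def by (rule Max_in[OF finite_card_subsets]) auto
  then show ?thesis
    by auto
qed

lemma clique_number_le:
  assumes "\<And>K. clique V E K \<Longrightarrow> card K \<le> k"
  shows "clique_number V E \<le> k"
proof -
  have "clique_number V E \<in> {card K | K. clique V E K}"
    unfolding clique_number_def clique_def by (rule Max_in[OF finite_card_subsets]) auto
  with assms show ?thesis
    by auto
qed

lemma independence_number_le:
  assumes "\<And>I. independent V E I \<Longrightarrow> card I \<le> k"
  shows "independence_number V E \<le> k"
proof -
  have "independence_number V E \<in> {card I | I. independent V E I}"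
    unfolding independence_number_def independent_def
    by (rule Max_in[OF finite_card_subsets]) auto
  with assms show ?thesis
    by auto
qed

section \<open>Colourings, cliques and clique partitions\<close>

lemma proper_colouring_L\<^sub>0: "\<exists>c. proper_colouring V E (L\<^sub>0 V E) c"
proof -
  define k where "k = L\<^sub>0 V E"
  define B where "B = {v \<in> V. k \<le> degree V E v}"
  have "finite B" and "B \<subseteq> V"
    unfolding B_def using finite_V by auto
  have "card B \<le> k"
  proof (rule ccontr)
    assume "\<not> card B \<le> k"
    then obtain C where C: "C \<subseteq> B" "card C = Suc k"
      by (metis not_less_eq_eq obtain_subset_with_card_n)
    \<comment> \<open>Each vertex of \<open>C\<close> has degree at least \<open>k\<close>, which is
      exactly \<open>card C - 1\<close>.\<close>
    then have "large V E C"
      unfolding large_def B_def by auto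
    with C show False
      using card_large_le[of C] k_def by simp
  qed
  \<comment> \<open>The greedy phase as an induction: \<open>T\<close> collects the low-degree
    vertices coloured so far, and \<open>B\<close> stays coloured throughout.\<close>
  have extend: "\<exists>c. c ` (B \<union> T) \<subseteq> {..<k} \<and>
      (\<forall>u\<in>B \<union> T. \<forall>v\<in>B \<union> T. {u, v} \<in> E \<longrightarrow> c u \<noteq> c v)"
    if "finite T" "T \<subseteq> V - B" for T
    using that
  proof (induction T)
    case empty
    obtain c :: "'a \<Rightarrow> nat" where c: "c ` B \<subseteq> {..<k}" "inj_on c B"
      using \<open>finite B\<close> \<open>card B \<le> k\<close> by (metis card_le_inj card_lessThan finite_lessThan)
    have "c u \<noteq> c v" if "u \<in> B" "v \<in> B" "{u, v} \<in> E" for u v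
      using that c(2) singleton_not_edge by (auto simp: inj_on_def)
    with c(1) show ?case
      by auto
  next
    case (insert x T)
    then obtain c where c: "c ` (B \<union> T) \<subseteq> {..<k}"
      "\<forall>u\<in>B \<union> T. \<forall>v\<in>B \<union> T. {u, v} \<in> E \<longrightarrow> c u \<noteq> c v"
      by auto
    have x: "x \<in> V" "x \<notin> B \<union> T" "degree V E x < k"
      using insert by (auto simp: B_def)
    define N where "N = {u \<in> V. {u, x} \<in> E}"
    \<comment> \<open>\<open>N\<close> also contains neighbours that are not yet coloured, where
      \<open>c\<close> is arbitrary. Avoiding their values too is harmless, since all of
      \<open>N\<close> has fewer than \<open>k\<close> elements.\<close>
    have "card (c ` N) < card {..<k}"
      using card_image_le[of N c] x finite_V by (simp add: N_def degree_def)
    then obtain i where i: "i < k" "i \<notin> c ` N"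
      using finite_V card_mono[of "c ` N" "{..<k}"] by (force simp: N_def)
    let ?c = "c(x := i)"
    have neq: "i \<noteq> c u" if "u \<in> B \<union> T" "{u, x} \<in> E" for u
      using that i \<open>B \<subseteq> V\<close> insert.prems by (auto simp: N_def)
    have "?c ` (B \<union> insert x T) \<subseteq> {..<k}"
      using c(1) i(1) by auto
    moreover have "?c u \<noteq> ?c v"
      if uv: "u \<in> B \<union> insert x T" "v \<in> B \<union> insert x T" "{u, v} \<in> E" for u v
    proof -
      have "u \<noteq> v"
        using uv(3) singleton_not_edge by auto
      then consider "u \<in> B \<union> T" "v \<in> B \<union> T" | "u = x" "v \<in> B \<union> T" | "v = x" "u \<in> B \<union> T"
        using uv(1,2) by blast
      then show ?thesis
      proof cases
        case 1
        with c(2) uv(3) x(2) show ?thesis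
          by auto
      next
        case 2
        with neq[of v] uv(3) x(2) show ?thesis
          by (auto simp: insert_commute)
      next
        case 3
        with neq[of u] uv(3) x(2) show ?thesis
          by auto
      qed
    qed
    ultimately show ?case
      by blast
  qed
  have "B \<union> (V - B) = V"
    using \<open>B \<subseteq> V\<close> by auto
  with extend[of "V - B"] finite_V show ?thesis
    unfolding proper_colouring_def k_def by simp
qed

lemma chromatic_number_le_L\<^sub>0: "chromatic_number V E \<le> L\<^sub>0 V E"
  unfolding chromatic_number_def using proper_colouring_L\<^sub>0 by (rule Least_le)

lemma chromatic_number_attained: "\<exists>c. proper_colouring V E (chromatic_number V E) c"
  unfolding chromatic_number_def using proper_colouring_L\<^sub>0 by (rule LeastI)

text \<open>A proper colouring is injective on every clique.\<close>

lemma clique_number_le_chromatic_number: "clique_number V E \<le> chromatic_number V E"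
proof (rule clique_number_le)
  fix K assume K: "clique V E K"
  obtain c where c: "proper_colouring V E (chromatic_number V E) c"
    using chromatic_number_attained by auto
  have "inj_on c K"
  proof (rule inj_onI, rule ccontr)
    fix u v assume "u \<in> K" "v \<in> K" "c u = c v" "u \<noteq> v"
    with K c show False
      unfolding clique_def proper_colouring_def by blast
  qed
  moreover have "c ` K \<subseteq> {..<chromatic_number V E}"
    using K c unfolding clique_def proper_colouring_def by blast
  ultimately show "card K \<le> chromatic_number V E"
    using card_inj_on_le[of c K "{..<chromatic_number V E}"] by simp
qed

text \<open>Mapping each vertex of an independent set to its block is injective: two vertices
  sharing a clique would be adjacent.\<close>

lemma independence_number_le_clique_partition_number:
  "independence_number V E \<le> clique_partition_number V E"
proof (rule independence_number_le)
  fix I assume I: "independent V E I"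
  \<comment> \<open>The partition into singletons shows that the set under \<open>LEAST\<close> is
    inhabited, so an optimal partition exists.\<close>
  have "\<exists>P. partition_on V P \<and> (\<forall>K\<in>P. clique V E K) \<and> card P = card ((\<lambda>v. {v}) ` V)"
    by (rule exI[of _ "(\<lambda>v. {v}) ` V"]) (auto simp: partition_on_def disjoint_def clique_def)
  then have "\<exists>P. partition_on V P \<and> (\<forall>K\<in>P. clique V E K) \<and>
      card P = clique_partition_number V E"
    unfolding clique_partition_number_def by (rule LeastI)
  then obtain P where P: "partition_on V P" "\<forall>K\<in>P. clique V E K"
    "card P = clique_partition_number V E"
    by auto
  have "finite P"
    using P(1) finite_V by (rule finite_elements[rotated])
  have "\<forall>v\<in>I. \<exists>K\<in>P. v \<in> K"
    using I P(1) by (auto simp: independent_def partition_on_def)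
  then obtain f where f: "\<And>v. v \<in> I \<Longrightarrow> f v \<in> P \<and> v \<in> f v"
    by metis
  have "inj_on f I"
  proof (rule inj_onI, rule ccontr)
    fix u v assume uv: "u \<in> I" "v \<in> I" "f u = f v" "u \<noteq> v"
    then have "clique V E (f u)" "u \<in> f u" "v \<in> f u"
      using f[of u] f[of v] P(2) by auto
    with uv I show False
      unfolding clique_def independent_def by blast
  qed
  with f \<open>finite P\<close> have "card I \<le> card P"
    by (intro card_inj_on_le[of f]) auto
  then show "card I \<le> clique_partition_number V E"
    by (simp add: P(3))
qed

section \<open>Degree sums and the quadratic bounds\<close>

lemma card_large_bound:
  assumes "large V E B"
  shows "(real (card B))\<^sup>2 - (real (min_degree V E) + 1) * real (card B)
    + real (card V) * real (min_degree V E) - 2 * real (card E) \<le> 0"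
proof -
  let ?\<delta> = "min_degree V E"
  have B: "B \<subseteq> V"
    using assms by (simp add: large_def)
  then have "finite B"
    using finite_V finite_subset by auto
  have "card B * (card B - 1) \<le> (\<Sum>v\<in>B. degree V E v)"
    using assms sum_bounded_below[of B "card B - 1" "degree V E"] by (simp add: large_def)
  then have "real (card B * (card B - 1)) \<le> real (\<Sum>v\<in>B. degree V E v)"
    by (rule of_nat_mono)
  \<comment> \<open>The case split absorbs the truncated subtraction: for empty \<open>B\<close>
    both sides are zero.\<close>
  moreover have "real (card B * (card B - 1)) = real (card B) * (real (card B) - 1)"
    by (cases "card B") (auto simp: algebra_simps)
  moreover have "card (V - B) * ?\<delta> \<le> (\<Sum>v\<in>V - B. degree V E v)"
    using sum_bounded_below[of "V - B" ?\<delta> "degree V E"] by (simp add: min_degree_le)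
  then have "real (card (V - B) * ?\<delta>) \<le> real (\<Sum>v\<in>V - B. degree V E v)"
    by (rule of_nat_mono)
  moreover have "real (card (V - B)) = real (card V) - real (card B)"
    using B \<open>finite B\<close> finite_V by (simp add: card_Diff_subset card_mono of_nat_diff)
  moreover have "real (\<Sum>v\<in>V - B. degree V E v) + real (\<Sum>v\<in>B. degree V E v) = 2 * real (card E)"
    using sum.subset_diff[OF B finite_V, of "degree V E"] sum_degree by linarith
  ultimately show ?thesis
    by (simp add: algebra_simps power2_eq_square)
qed

lemma card_times_min_degree_le: "card V * min_degree V E \<le> 2 * card E"
  using sum_bounded_below[of V "min_degree V E" "degree V E"] by (simp add: min_degree_le sum_degree)

lemma double_card_edges_le: "2 * card E \<le> card V * (card V - 1)"
  using sum_bounded_above[of V "degree V E" "card V - 1"] degree_less_card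
  by (force simp: sum_degree)

lemma min_degree_less_card: "min_degree V E < card V"
  using nonempty_V min_degree_le degree_less_card by (meson all_not_in_conv le_less_trans)

text \<open>Complete the square in the quadratic inequality for a large set of maximum size.\<close>

lemma L\<^sub>0_bound:
  defines "s \<equiv> sqrt ((real (min_degree V E) + 1)\<^sup>2 / 4
    - real (card V) * real (min_degree V E) + 2 * real (card E))"
  shows "real (L\<^sub>0 V E) \<le> (real (min_degree V E) + 1) / 2 + s" (is "?l \<le> ?b / 2 + _")
proof -
  obtain B where "large V E B" "card B = L\<^sub>0 V E"
    using L\<^sub>0_attained by auto
  from card_large_bound[OF this(1)] this(2)
  have "(?l - ?b / 2)\<^sup>2
      \<le> ?b\<^sup>2 / 4 - real (card V) * real (min_degree V E) + 2 * real (card E)"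
    by (simp add: power2_eq_square field_simps)
  then have "?l - ?b / 2 \<le> s"
    unfolding s_def by (rule real_le_rsqrt)
  then show ?thesis
    by simp
qed

lemma min_degree_root_le:
  defines "s \<equiv> sqrt ((real (min_degree V E) + 1)\<^sup>2 / 4
    - real (card V) * real (min_degree V E) + 2 * real (card E))"
  shows "(real (min_degree V E) + 1) / 2 + s \<le> 1 / 2 + sqrt (1 / 4 + 2 * real (card E))"
proof -
  define n m d where "n = real (card V)" and "m = real (card E)" and "d = real (min_degree V E)"
  define x where "x = (d + 1) / 2 + s"
  have "n \<ge> 1"
    using nonempty_V finite_V by (simp add: n_def Suc_le_eq card_gt_0_iff)
  have "d \<ge> 0" and dn: "d + 1 \<le> n"
    using min_degree_less_card by (auto simp: d_def n_def)
  have lo: "n * d \<le> 2 * m"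
    using of_nat_mono[OF card_times_min_degree_le, where ?'a = real]
    by (simp add: n_def d_def m_def)
  have "card V \<ge> 1"
    using \<open>n \<ge> 1\<close> by (simp add: n_def)
  then have hi: "2 * m \<le> n * (n - 1)"
    using of_nat_mono[OF double_card_edges_le, where ?'a = real]
    by (simp add: n_def m_def of_nat_diff)
  have s: "s = sqrt ((d + 1)\<^sup>2 / 4 - n * d + 2 * m)"
    by (simp add: s_def n_def m_def d_def)
  \<comment> \<open>The radicand is nonnegative because of \<open>lo\<close>.\<close>
  have "s\<^sup>2 = (d + 1)\<^sup>2 / 4 - n * d + 2 * m"
    unfolding s using lo zero_le_power2[of "d + 1"] by (intro real_sqrt_pow2) linarith
  \<comment> \<open>The quadratic equation for \<open>x\<close>, arranged so that only the sign of
    \<open>n - x\<close> remains to be settled.\<close>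
  then have root: "x * (x - 1) = 2 * m - d * (n - x)"
    by (simp add: x_def power2_eq_square field_simps)
  have "s \<le> n - (d + 1) / 2"
    unfolding s
  proof (rule real_le_lsqrt)
    show "0 \<le> n - (d + 1) / 2"
      using dn \<open>n \<ge> 1\<close> by simp
    \<comment> \<open>After expanding and cancelling the square of \<open>(d + 1) / 2\<close>, this
      is precisely \<open>hi\<close>.\<close>
    show "(d + 1)\<^sup>2 / 4 - n * d + 2 * m \<le> (n - (d + 1) / 2)\<^sup>2"
      using hi by (simp add: power2_eq_square field_simps)
  qed
  then have "x \<le> n"
    by (simp add: x_def)
  with \<open>d \<ge> 0\<close> have "0 \<le> d * (n - x)"
    by simp
  with root have "x * (x - 1) \<le> 2 * m"
    by linarith
  then have "(x - 1 / 2)\<^sup>2 \<le> 1 / 4 + 2 * m"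
    by (simp add: power2_eq_square field_simps)
  then have "x - 1 / 2 \<le> sqrt (1 / 4 + 2 * m)"
    by (rule real_le_rsqrt)
  then show ?thesis
    by (simp add: x_def m_def d_def)
qed

section \<open>Transfer to the complement graph\<close>

lemma simple_graph_complement: "simple_graph V (complement_edges V E)"
  by unfold_locales (auto simp: finite_V nonempty_V complement_edges_def)

lemma doubleton_in_complement_edges:
  assumes "u \<in> V" "v \<in> V"
  shows "{u, v} \<in> complement_edges V E \<longleftrightarrow> u \<noteq> v \<and> {u, v} \<notin> E"
  using assms unfolding complement_edges_def by (cases "u = v") simp_all

lemma degree_complement:
  assumes "v \<in> V"
  shows "degree V (complement_edges V E) v = card V - 1 - degree V E v"
proof -
  have "{u \<in> V. {u, v} \<in> complement_edges V E} = V - {v} - {u \<in> V. {u, v} \<in> E}"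
    using assms doubleton_in_complement_edges[of _ v] by blast
  moreover have "{u \<in> V. {u, v} \<in> E} \<subseteq> V - {v}"
    using singleton_not_edge by auto
  ultimately show ?thesis
    using assms finite_V by (simp add: degree_def card_Diff_subset finite_subset)
qed

text \<open>The map taking \<open>k\<close> to \<open>card V - 1 - k\<close> is antitone, so it
  turns the maximum into a minimum.\<close>

lemma min_degree_complement:
  "min_degree V (complement_edges V E) = card V - 1 - max_degree V E"
proof -
  have "degree V (complement_edges V E) ` V = (\<lambda>k. card V - 1 - k) ` degree V E ` V"
    by (auto simp: degree_complement image_image)
  moreover have "Min ((\<lambda>k. card V - 1 - k) ` degree V E ` V) = card V - 1 - Max (degree V E ` V)"
  proof (intro Min_eqI)
    show "card V - 1 - Max (degree V E ` V) \<in> (\<lambda>k. card V - 1 - k) ` degree V E ` V"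
      using finite_V nonempty_V by (intro imageI Max_in) auto
  qed (use finite_V in \<open>auto intro!: diff_le_mono2\<close>)
  ultimately show ?thesis
    by (simp add: min_degree_def max_degree_def)
qed

lemma max_degree_less_card: "max_degree V E < card V"
  unfolding max_degree_def using finite_V nonempty_V degree_less_card by simp

text \<open>\<open>E\<close> and its complement split the two-element subsets of \<open>V\<close>.
  The real-valued, doubled form can be substituted directly into the radicands.\<close>

lemma card_complement_edges:
  "2 * real (card (complement_edges V E))
    = (real (card V))\<^sup>2 - real (card V) - 2 * real (card E)"
proof -
  let ?U = "{e. e \<subseteq> V \<and> card e = 2}"
  have "card ?U = card V choose 2"
    by (rule n_subsets[OF finite_V])
  have "finite ?U"
    using finite_V by auto
  then have "real (card (complement_edges V E)) = real (card V choose 2) - real (card E)"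
    unfolding complement_edges_def \<open>card ?U = card V choose 2\<close>[symmetric]
    using edges finite_E by (simp add: card_Diff_subset card_mono of_nat_diff)
  moreover have "2 * real (card V choose 2) = (real (card V))\<^sup>2 - real (card V)"
  proof -
    have "2 * (card V choose 2) = card V * (card V - 1)"
      by (simp add: choose_two algebra_simps)
    then have "2 * real (card V choose 2) = real (card V * (card V - 1))"
      by (metis of_nat_mult of_nat_numeral)
    then show ?thesis
      by (cases "card V") (auto simp: power2_eq_square algebra_simps)
  qed
  ultimately show ?thesis
    by simp
qed

lemma large_complement_iff: "large V (complement_edges V E) A \<longleftrightarrow> small V E A"
proof -
  have "card A - 1 \<le> degree V (complement_edges V E) v \<longleftrightarrow> degree V E v \<le> card V - card A"
    if "A \<subseteq> V" "v \<in> A" for v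
  proof -
    \<comment> \<open>These facts keep \<open>card A - 1\<close> and \<open>card V - card A\<close>
      from truncating, so the two degree conditions are rearrangements of each other.\<close>
    have "v \<in> V" "card A > 0" "card A \<le> card V"
      using that finite_V by (auto simp: card_gt_0_iff card_mono intro: finite_subset)
    with degree_less_card[of v] show ?thesis
      by (auto simp: degree_complement)
  qed
  then show ?thesis
    unfolding large_def small_def by blast
qed

lemma L\<^sub>0_complement: "L\<^sub>0 V (complement_edges V E) = S\<^sub>0 V E"
  by (simp add: L\<^sub>0_def S\<^sub>0_def large_complement_iff)

text \<open>Colour classes of the complement are cliques of the graph itself.\<close>

lemma clique_partition_number_le_colours:
  assumes "proper_colouring V (complement_edges V E) k c"
  shows "clique_partition_number V E \<le> k"
proof -
  define cls where "cls i = {v \<in> V. c v = i}" for i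
  \<comment> \<open>Only colours that occur are used, since a partition has no empty block.\<close>
  let ?P = "cls ` c ` V"
  have "partition_on V ?P"
    by (auto simp: partition_on_def disjoint_def cls_def)
  moreover have "clique V E (cls i)" for i
    unfolding clique_def
  proof (intro conjI ballI impI)
    fix u v assume uv: "u \<in> cls i" "v \<in> cls i" "u \<noteq> v"
    then have "u \<in> V" "v \<in> V" "c u = c v"
      by (auto simp: cls_def)
    with assms have "{u, v} \<notin> complement_edges V E"
      unfolding proper_colouring_def by blast
    with uv(3) \<open>u \<in> V\<close> \<open>v \<in> V\<close> show "{u, v} \<in> E"
      by (simp add: doubleton_in_complement_edges)
  qed (auto simp: cls_def)
  ultimately have "clique_partition_number V E \<le> card ?P"
    unfolding clique_partition_number_def by (intro Least_le) auto
  also have "\<dots> \<le> card (c ` V)"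
    using finite_V by (simp add: card_image_le)
  also have "\<dots> \<le> card {..<k}"
    using assms by (intro card_mono) (auto simp: proper_colouring_def)
  finally show ?thesis
    by simp
qed

lemma clique_partition_number_le_S\<^sub>0: "clique_partition_number V E \<le> S\<^sub>0 V E"
  using simple_graph.proper_colouring_L\<^sub>0[OF simple_graph_complement]
  by (auto simp: L\<^sub>0_complement intro: clique_partition_number_le_colours)

end

theorem corollary5p2:
  fixes V :: "'a set" and E :: "'a set set" and n e \<Delta> \<delta> :: nat
  assumes "simple_graph V E"
    and "n = card V" and "e = card E"
    and "\<Delta> = max_degree V E" and "\<delta> = min_degree V E"
  shows
    "(independence_number V E \<le> clique_partition_number V E \<and>
      clique_partition_number V E \<le> S\<^sub>0 V E \<and>
      int (S\<^sub>0 V E) \<le> \<lfloor>(real n - real \<Delta>) / 2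
          + sqrt ((real n - real \<Delta>)\<^sup>2 / 4 + real n * real \<Delta> - 2 * real e)\<rfloor> \<and>
      \<lfloor>(real n - real \<Delta>) / 2
          + sqrt ((real n - real \<Delta>)\<^sup>2 / 4 + real n * real \<Delta> - 2 * real e)\<rfloor>
        \<le> \<lfloor>1 / 2 + sqrt (1 / 4 + (real n)\<^sup>2 - real n - 2 * real e)\<rfloor>) \<and>
     (clique_number V E \<le> chromatic_number V E \<and>
      chromatic_number V E \<le> L\<^sub>0 V E \<and>
      int (L\<^sub>0 V E) \<le> \<lfloor>(real \<delta> + 1) / 2
          + sqrt ((real \<delta> + 1)\<^sup>2 / 4 - real n * real \<delta> + 2 * real e)\<rfloor> \<and>
      \<lfloor>(real \<delta> + 1) / 2
          + sqrt ((real \<delta> + 1)\<^sup>2 / 4 - real n * real \<delta> + 2 * real e)\<rfloor>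
        \<le> \<lfloor>1 / 2 + sqrt (1 / 4 + 2 * real e)\<rfloor>)"
proof -
  interpret simple_graph V E
    by (rule assms(1))
  let ?F = "complement_edges V E"
  interpret complement: simple_graph V ?F
    by (rule simple_graph_complement)
  have d: "real (min_degree V ?F) = real n - 1 - real \<Delta>"
    using max_degree_less_card assms(2,4) by (simp add: min_degree_complement of_nat_diff)
  then have b: "real (min_degree V ?F) + 1 = real n - real \<Delta>"
    by simp
  have m: "2 * real (card ?F) = (real n)\<^sup>2 - real n - 2 * real e"
    using card_complement_edges assms(2,3) by simp
  \<comment> \<open>With \<open>d\<close> and \<open>m\<close> inserted, the terms in
    \<open>n\<close> alone cancel: -n(n - 1 - \<Delta>) + n(n - 1) leaves n\<Delta>.\<close>
  have radicand: "(real n - real \<Delta>)\<^sup>2 / 4 - real (card V) * real (min_degree V ?F)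
      + 2 * real (card ?F) = (real n - real \<Delta>)\<^sup>2 / 4 + real n * real \<Delta> - 2 * real e"
    unfolding d m assms(2)[symmetric] by (simp add: power2_eq_square algebra_simps)
  have "real (S\<^sub>0 V E) \<le> (real n - real \<Delta>) / 2
      + sqrt ((real n - real \<Delta>)\<^sup>2 / 4 + real n * real \<Delta> - 2 * real e)"
    using complement.L\<^sub>0_bound unfolding b radicand L\<^sub>0_complement .
  moreover have "(real n - real \<Delta>) / 2
      + sqrt ((real n - real \<Delta>)\<^sup>2 / 4 + real n * real \<Delta> - 2 * real e)
      \<le> 1 / 2 + sqrt (1 / 4 + (real n)\<^sup>2 - real n - 2 * real e)"
    using complement.min_degree_root_le unfolding b radicand unfolding m by (simp add: algebra_simps)
  ultimately show ?thesis
    using independence_number_le_clique_partition_number clique_partition_number_le_S\<^sub>0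
      clique_number_le_chromatic_number chromatic_number_le_L\<^sub>0
      L\<^sub>0_bound min_degree_root_le
    unfolding assms(2-5) by (intro conjI floor_mono) (simp_all add: le_floor_iff)
qed

end
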